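(* Let $A^\ast_{n,\le m}$, $\xi_n$, $\alpha_j$ be taken from any one of the four families (Bernoulli, Cauchy, Euler, Euler of the second kind) described in the context, with the corresponding integer parameter $N$. For integers $n$ and $m$ with $n\ge m\ge 1$, we have $$A_{n,\le m}^\ast=\xi_n\det(M),$$ where $M=(M_{i,j})_{1\le i,j\le n}$ is the $n\times n$ banded Toeplitz matrix with $$M_{i,j}=\begin{cases}\alpha_{i-j+1}&\text{if }1\le i-j+1\le m,\\ 1&\text{if } j=i+1,\\ 0&\text{otherwise.}\end{cases}$$
   Context: $(x)^{(n)}=x(x+1)\cdots(x+n-1)$ for $n\ge1$ and $(x)^{(0)}=1$ (rising factorial). All identities below are between formal power series in $x$. For an integer $m\ge 1$ define the modified restricted hypergeometric numbers by: - Bernoulli ($N\ge1$): $\left(\sum_{n=0}^{m}\frac{x^n}{(N+1)^{(n)}}\right)^{-1}=\sum_{n=0}^\infty B_{N,n,\le m}^\ast\frac{x^n}{n!}$; - Cauchy ($N\ge1$): $\left(N\sum_{n=0}^{m}\frac{(-x)^n}{N+n}\right)^{-1}=\sum_{n=0}^\infty c_{N,n,\le m}^\ast\frac{x^n}{n!}$; - Euler ($N\ge0$): $\left(\sum_{n=0}^{m}\frac{x^{2n}}{(2N+1)^{(2n)}}\right)^{-1}=\sum_{n=0}^\infty E_{N,n,\le m}^\ast\frac{x^n}{n!}$; - Euler of the second kind ($N\ge0$): $\left(\sum_{n=0}^{m}\frac{x^{2n}}{(2N+2)^{(2n)}}\right)^{-1}=\sum_{n=0}^\infty\widehat E_{N,n,\le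 m}^\ast\frac{x^n}{n!}$. The symbols $A^\ast_{n,\le m}$, $\xi_n$ ($n\ge0$), $\alpha_j$ ($j\ge1$) denote simultaneously one of the following choices ($N$ is suppressed from the notation): - Bernoulli: $A^\ast_{n,\le m}=B^\ast_{N,n,\le m}$, $\xi_n=(-1)^n n!$, $\alpha_j=\frac{N!}{(N+j)!}$, $N\ge1$; - Cauchy: $A^\ast_{n,\le m}=c^\ast_{N,n,\le m}$, $\xi_n=n!$, $\alpha_j=\frac{N}{N+j}$, $N\ge1$; - Euler: $A^\ast_{n,\le m}=E^\ast_{N,2n,\le m}$, $\xi_n=(-1)^n(2n)!$, $\alpha_j=\frac{(2N)!}{(2N+2j)!}$, $N\ge0$; - Euler of the second kind: $A^\ast_{n,\le m}=\widehat E^\ast_{N,2n,\le m}$, $\xi_n=(-1)^n(2n)!$, $\alpha_j=\frac{(2N+1)!}{(2N+2j+1)!}$, $N\ge0$. *)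

theory Defs
  imports
    "HOL-Computational_Algebra.Formal_Power_Series"
    "Jordan_Normal_Form.Determinant"
begin

text \<open>
  The numbers attached to a generating function are read off from its exponential coefficients:
  \<open>f = (\<Sum>n. egf_coeff f n / fact n * x ^ n)\<close>.
\<close>

definition egf_coeff :: "rat fps \<Rightarrow> nat \<Rightarrow> rat" where
  "egf_coeff f n = fact n * fps_nth f n"

lemma egf_coeff_unique:
  "f = Abs_fps (\<lambda>n. a n / fact n) \<longleftrightarrow> (\<forall>n. a n = egf_coeff f n)"
  by (auto simp: egf_coeff_def fps_eq_iff field_simps)

definition bernoulli_denom :: "nat \<Rightarrow> nat \<Rightarrow> rat fps" where
  "bernoulli_denom N m =
     (\<Sum>n=0..m. fps_const (1 / pochhammer (of_nat N + 1) n) * fps_X ^ n)"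

definition cauchy_denom :: "nat \<Rightarrow> nat \<Rightarrow> rat fps" where
  "cauchy_denom N m =
     of_nat N * (\<Sum>n=0..m. fps_const (1 / (of_nat N + of_nat n)) * (- fps_X) ^ n)"

definition euler_denom :: "nat \<Rightarrow> nat \<Rightarrow> rat fps" where
  "euler_denom N m =
     (\<Sum>n=0..m. fps_const (1 / pochhammer (2 * of_nat N + 1) (2 * n)) * fps_X ^ (2 * n))"

definition euler2_denom :: "nat \<Rightarrow> nat \<Rightarrow> rat fps" where
  "euler2_denom N m =
     (\<Sum>n=0..m. fps_const (1 / pochhammer (2 * of_nat N + 2) (2 * n)) * fps_X ^ (2 * n))"

text \<open>
  All four series have constant coefficient 1 for the \<open>N\<close> in question, so that \<open>inverse\<close>
  is the genuine multiplicative inverse.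
\<close>

lemma denom_nth_0:
  "fps_nth (bernoulli_denom N m) 0 = 1"
  "N \<ge> 1 \<Longrightarrow> fps_nth (cauchy_denom N m) 0 = 1"
  "fps_nth (euler_denom N m) 0 = 1"
  "fps_nth (euler2_denom N m) 0 = 1"
  by (simp_all add: bernoulli_denom_def cauchy_denom_def euler_denom_def euler2_denom_def
        fps_sum_nth sum.atLeast_Suc_atMost power_0_left fps_nth_power_0)

definition bernoulli_star :: "nat \<Rightarrow> nat \<Rightarrow> nat \<Rightarrow> rat" where
  "bernoulli_star N m n = egf_coeff (inverse (bernoulli_denom N m)) n"

definition cauchy_star :: "nat \<Rightarrow> nat \<Rightarrow> nat \<Rightarrow> rat" where
  "cauchy_star N m n = egf_coeff (inverse (cauchy_denom N m)) n"

definition euler_star :: "nat \<Rightarrow> nat \<Rightarrow> nat \<Rightarrow> rat" where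
  "euler_star N m n = egf_coeff (inverse (euler_denom N m)) n"

definition euler2_star :: "nat \<Rightarrow> nat \<Rightarrow> nat \<Rightarrow> rat" where
  "euler2_star N m n = egf_coeff (inverse (euler2_denom N m)) n"

datatype family = Bernoulli | Cauchy | Euler | Euler2

fun valid_param :: "family \<Rightarrow> nat \<Rightarrow> bool" where
  "valid_param Bernoulli N \<longleftrightarrow> N \<ge> 1"
| "valid_param Cauchy N \<longleftrightarrow> N \<ge> 1"
| "valid_param Euler N \<longleftrightarrow> True"
| "valid_param Euler2 N \<longleftrightarrow> True"

fun A_star :: "family \<Rightarrow> nat \<Rightarrow> nat \<Rightarrow> nat \<Rightarrow> rat" where
  "A_star Bernoulli N m n = bernoulli_star N m n"
| "A_star Cauchy N m n = cauchy_star N m n"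
| "A_star Euler N m n = euler_star N m (2 * n)"
| "A_star Euler2 N m n = euler2_star N m (2 * n)"

fun xi :: "family \<Rightarrow> nat \<Rightarrow> rat" where
  "xi Bernoulli n = (- 1) ^ n * fact n"
| "xi Cauchy n = fact n"
| "xi Euler n = (- 1) ^ n * fact (2 * n)"
| "xi Euler2 n = (- 1) ^ n * fact (2 * n)"

fun alpha :: "family \<Rightarrow> nat \<Rightarrow> nat \<Rightarrow> rat" where
  "alpha Bernoulli N j = fact N / fact (N + j)"
| "alpha Cauchy N j = of_nat N / of_nat (N + j)"
| "alpha Euler N j = fact (2 * N) / fact (2 * N + 2 * j)"
| "alpha Euler2 N j = fact (2 * N + 1) / fact (2 * N + 2 * j + 1)"

text \<open>
  Matrix indices start at 0 here; the entries depend only on \<open>i - j\<close>, so shifting both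
  indices by 1 changes nothing. The guard \<open>j \<le> i\<close> expresses \<open>1 \<le> i - j + 1\<close>
  without truncated subtraction.
\<close>

definition banded_toeplitz :: "(nat \<Rightarrow> rat) \<Rightarrow> nat \<Rightarrow> nat \<Rightarrow> rat mat" where
  "banded_toeplitz a m n = mat n n (\<lambda>(i, j).
     if j \<le> i \<and> i - j + 1 \<le> m then a (i - j + 1)
     else if j = i + 1 then 1
     else 0)"

end

theory Submission
  imports Defs
begin

text \<open>
  The reciprocal \<open>g\<close> of a power series \<open>f\<close> with constant term 1 solves a triangular linear
  system: for every \<open>n\<close>, the lower triangular Toeplitz matrix \<open>T\<close> of order \<open>n + 1\<close> with entries
  \<open>f\<^sub>i\<^sub>-\<^sub>j\<close> sends \<open>(g\<^sub>0, \<dots>, g\<^sub>n)\<close> to the first unit vector.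
  Since \<open>det T = 1\<close>, the inverse of \<open>T\<close> is its adjugate, so \<open>g\<^sub>n\<close> is the cofactor of \<open>T\<close> at the
  top right corner. Deleting the first row and the last column moves the unit diagonal of \<open>T\<close> one
  place above the new diagonal, and the minor that remains is exactly the Hessenberg Toeplitz
  matrix of the formula; its sign is \<open>(-1)\<^sup>n\<close>
  (lemma \<open>fps_nth_inverse_eq_Toeplitz_det\<close>).

  All four families are instances of this. With \<open>\<alpha>\<^sub>0 = 1\<close> and
  \<open>f = (\<Sum>k\<le>m. \<alpha>\<^sub>k x\<^sup>k)\<close>, the denominators are \<open>f(x)\<close> (Bernoulli), \<open>f(-x)\<close> (Cauchy) and
  \<open>f(x\<^sup>2)\<close> (both Euler families). A substitution of \<open>c x\<^sup>d\<close> commutes with taking reciprocals and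
  multiplies the coefficient of \<open>x\<^sup>n\<close> by \<open>c\<^sup>n\<close> while moving it to \<open>x\<^bsup>d n\<^esup>\<close>
  (lemma \<open>fps_nth_inverse_eq_det_banded_toeplitz\<close>), which together with
  \<open>(-1)\<^sup>n\<close> accounts for the sign in \<open>\<xi>\<^sub>n\<close> and for the index \<open>2 n\<close> in the Euler cases.
\<close>

text \<open>
  Inverting the triangular Toeplitz matrix of \<open>f\<close> through its adjugate turns the solution of the
  convolution equations \<open>f g = 1\<close> into a single cofactor, so no recursion for the Hessenberg
  determinants has to be set up.
\<close>

lemma fps_nth_inverse_eq_Toeplitz_det:
  fixes f :: "'a :: field fps"
  assumes f0: "fps_nth f 0 = 1"
  shows "fps_nth (inverse f) n =
    (- 1) ^ n * det (mat n n (\<lambda>(i, j). if j \<le> i + 1 then fps_nth f (i + 1 - j) else 0))"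
proof -
  define T where "T = mat (Suc n) (Suc n) (\<lambda>(i, j). if j \<le> i then fps_nth f (i - j) else 0)"
  define g where "g = vec (Suc n) (fps_nth (inverse f))"
  have T: "T \<in> carrier_mat (Suc n) (Suc n)" and g: "g \<in> carrier_vec (Suc n)"
    by (simp_all add: T_def g_def)
  have "det T = prod_list (diag_mat T)"
    by (rule det_lower_triangular[OF _ T]) (auto simp: T_def)
  also have "diag_mat T = map (\<lambda>i. 1) [0..<Suc n]"
    unfolding diag_mat_def by (intro map_cong) (auto simp: T_def f0)
  also have "prod_list \<dots> = 1"
    by (induction n) auto
  finally have det_T: "det T = 1" .
  \<comment> \<open>The rows of this system are the coefficients of \<open>f g = 1\<close> up to degree \<open>n\<close>.\<close>
  have Tg: "T *\<^sub>v g = unit_vec (Suc n) 0"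
  proof (rule eq_vecI)
    fix i assume "i < dim_vec (unit_vec (Suc n) 0 :: 'a vec)"
    then have i: "i < Suc n" by simp
    then have "(T *\<^sub>v g) $ i =
        (\<Sum>j<Suc n. (if j \<le> i then fps_nth f (i - j) else 0) * fps_nth (inverse f) j)"
      by (simp add: T_def g_def scalar_prod_def atLeast0LessThan)
    also have "\<dots> = (\<Sum>j=0..i. fps_nth (inverse f) j * fps_nth f (i - j))"
      using i by (intro sum.mono_neutral_cong_right) auto
    also have "\<dots> = fps_nth (inverse f * f) i"
      by (simp add: fps_mult_nth)
    also have "inverse f * f = 1"
      using f0 by (intro inverse_mult_eq_1) simp
    finally show "(T *\<^sub>v g) $ i = unit_vec (Suc n) 0 $ i"
      using i by (simp add: unit_vec_def)
  qed (simp add: T_def)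
  have adj_T: "adj_mat T * T = 1\<^sub>m (Suc n)"
    unfolding adj_mat(3)[OF T] det_T by (rule eq_matI) auto
  have "g = (adj_mat T * T) *\<^sub>v g"
    using g by (simp add: adj_T)
  also have "\<dots> = adj_mat T *\<^sub>v unit_vec (Suc n) 0"
    using assoc_mult_mat_vec[OF adj_mat(1)[OF T] T g] by (simp add: Tg)
  also have "\<dots> $ n = adj_mat T $$ (n, 0)"
    using adj_mat(1)[OF T] by simp
  also have "\<dots> = cofactor T 0 n"
    by (simp add: adj_mat_def T_def)
  also have "mat_delete T 0 n =
      mat n n (\<lambda>(i, j). if j \<le> i + 1 then fps_nth f (i + 1 - j) else 0)"
    unfolding mat_delete_def by (rule eq_matI) (auto simp: T_def)
  then have "cofactor T 0 n = (- 1) ^ n *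
      det (mat n n (\<lambda>(i, j). if j \<le> i + 1 then fps_nth f (i + 1 - j) else 0))"
    by (simp add: cofactor_def)
  finally show ?thesis
    by (simp add: g_def)
qed

lemma fps_nth_compose_monomial:
  fixes f :: "'a :: comm_ring_1 fps"
  assumes "d > 0"
  shows "fps_nth (f oo (fps_const c * fps_X ^ d)) (d * n) = c ^ n * fps_nth f n"
proof -
  have monomial: "(fps_const c * fps_X ^ d) ^ i = fps_const (c ^ i) * fps_X ^ (d * i)" for i
    by (simp add: power_mult_distrib fps_const_power power_mult)
  have "fps_nth (f oo (fps_const c * fps_X ^ d)) (d * n) =
      (\<Sum>i=0..d * n. if i = n then c ^ n * fps_nth f n else 0)"
    using assms unfolding fps_compose_nth monomial
    by (intro sum.cong) (auto simp: fps_X_power_iff mult.commute)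
  also have "\<dots> = c ^ n * fps_nth f n"
    using assms by simp
  finally show ?thesis .
qed

text \<open>
  The common form of the four families: \<open>(c, d)\<close> is \<open>(1, 1)\<close> for Bernoulli, \<open>(-1, 1)\<close> for Cauchy
  and \<open>(1, 2)\<close> for both Euler families. Truncating \<open>f\<close> at degree \<open>m\<close> is what makes the matrix
  banded, and \<open>a\<^sub>0 = 1\<close> is its superdiagonal.
\<close>

lemma fps_nth_inverse_eq_det_banded_toeplitz:
  fixes a :: "nat \<Rightarrow> rat"
  assumes a0: "a 0 = 1" and d: "d > 0"
  shows "fps_nth (inverse (\<Sum>k=0..m. fps_const (a k) * (fps_const c * fps_X ^ d) ^ k)) (d * n) =
    (- c) ^ n * det (banded_toeplitz a m n)"
proof -
  define f where "f = (\<Sum>k=0..m. fps_const (a k) * fps_X ^ k)"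
  let ?s = "fps_const c * fps_X ^ d"
  have s0: "fps_nth ?s 0 = 0"
    using d by simp
  have f_nth: "fps_nth f k = (if k \<le> m then a k else 0)" for k
    by (simp add: f_def fps_sum_nth fps_X_power_iff if_distrib cong: if_cong)
  have "f oo ?s = (\<Sum>k=0..m. fps_const (a k) * ?s ^ k)"
    using d s0 by (simp add: f_def fps_compose_sum_distrib fps_compose_mult_distrib
        fps_compose_power[symmetric])
  then have "fps_nth (inverse (\<Sum>k=0..m. fps_const (a k) * ?s ^ k)) (d * n) =
      fps_nth (inverse f oo ?s) (d * n)"
    using s0 by (simp add: fps_inverse_compose f_nth a0)
  also have "\<dots> = c ^ n * fps_nth (inverse f) n"
    by (rule fps_nth_compose_monomial[OF d])
  also have "\<dots> = (- c) ^ n *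
      det (mat n n (\<lambda>(i, j). if j \<le> i + 1 then fps_nth f (i + 1 - j) else 0))"
    using a0 by (simp add: fps_nth_inverse_eq_Toeplitz_det f_nth power_minus[of c] mult_ac)
  also have "mat n n (\<lambda>(i, j). if j \<le> i + 1 then fps_nth f (i + 1 - j) else 0) =
      banded_toeplitz a m n"
    unfolding banded_toeplitz_def
    by (rule eq_matI) (auto simp: f_nth a0 Suc_diff_le le_Suc_eq)
  finally show ?thesis .
qed

lemma inverse_pochhammer_eq_fact_ratio:
  "1 / pochhammer (of_nat N + 1) k = (fact N / fact (N + k) :: 'a :: field_char_0)"
proof -
  have "fact (N + k) = fact N * (pochhammer (of_nat N + 1) k :: 'a)"
    using pochhammer_product'[of "1 :: 'a" N k] by (simp add: pochhammer_fact add.commute)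
  then show ?thesis
    by simp
qed

text \<open>
  Extending \<open>\<alpha>\<close> to the index 0 by its own formula gives 1 for every admissible \<open>N\<close>; thus the sums
  that define the denominators are \<open>(\<Sum>k\<le>m. \<alpha>\<^sub>k y\<^sup>k)\<close> with the constant term included.
\<close>

lemma alpha_0: "valid_param F N \<Longrightarrow> alpha F N 0 = 1"
  by (cases F) auto

lemma bernoulli_denom_eq:
  "bernoulli_denom N m =
    (\<Sum>k=0..m. fps_const (alpha Bernoulli N k) * (fps_const 1 * fps_X ^ 1) ^ k)"
  by (simp add: bernoulli_denom_def inverse_pochhammer_eq_fact_ratio)

lemma cauchy_denom_eq:
  "cauchy_denom N m =
    (\<Sum>k=0..m. fps_const (alpha Cauchy N k) * (fps_const (- 1) * fps_X ^ 1) ^ k)"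
proof -
  have "fps_const (- 1) * fps_X = (- fps_X :: rat fps)"
    by (simp flip: fps_const_neg)
  then show ?thesis
    by (simp add: cauchy_denom_def sum_distrib_left fps_of_nat[symmetric] mult.assoc[symmetric]
        del: fps_const_neg)
qed

lemma euler_denom_eq:
  "euler_denom N m =
    (\<Sum>k=0..m. fps_const (alpha Euler N k) * (fps_const 1 * fps_X ^ 2) ^ k)"
  using inverse_pochhammer_eq_fact_ratio[of "2 * N", where 'a = rat]
  by (simp add: euler_denom_def flip: power_mult)

lemma euler2_denom_eq:
  "euler2_denom N m =
    (\<Sum>k=0..m. fps_const (alpha Euler2 N k) * (fps_const 1 * fps_X ^ 2) ^ k)"
proof -
  have "1 / pochhammer (2 * of_nat N + 2) (2 * k) = alpha Euler2 N k" for k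
    using inverse_pochhammer_eq_fact_ratio[of "2 * N + 1" "2 * k", where 'a = rat]
    by (simp add: add_ac del: fact_Suc)
  then show ?thesis
    by (simp add: euler2_denom_def del: alpha.simps flip: power_mult)
qed

theorem proposition2:
  fixes F :: family and N m n :: nat
  assumes "valid_param F N" and "m \<ge> 1" and "n \<ge> m"
  shows "A_star F N m n = xi F n * det (banded_toeplitz (alpha F N) m n)"
proof -
  note coeff = fps_nth_inverse_eq_det_banded_toeplitz[where a = "alpha F N", OF alpha_0[OF assms(1)]]
  show ?thesis
  proof (cases F)
    case Bernoulli
    then show ?thesis
      using coeff[where d = 1 and c = 1 and m = m and n = n]
      by (simp add: bernoulli_star_def egf_coeff_def bernoulli_denom_eq del: alpha.simps)
  next
    case Cauchy
    then show ?thesis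
      using coeff[where d = 1 and c = "- 1" and m = m and n = n]
      by (simp add: cauchy_star_def egf_coeff_def cauchy_denom_eq del: alpha.simps)
  next
    case Euler
    then show ?thesis
      using coeff[where d = 2 and c = 1 and m = m and n = n]
      by (simp add: euler_star_def egf_coeff_def euler_denom_eq del: alpha.simps)
  next
    case Euler2
    then show ?thesis
      using coeff[where d = 2 and c = 1 and m = m and n = n]
      by (simp add: euler2_star_def egf_coeff_def euler2_denom_eq del: alpha.simps)
  qed
qed

end
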